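(* Let $(E,\omega)$ be an LV-graph and $R$ a domain. Then $L_R(E,\omega)$ is not von Neumann regular, and it is not graded von Neumann regular.
   Context: A weighted graph $(E,\omega)$, $E=(E^0,E^{\mathrm{st}},E^1,s,r,\omega)$, consists of countable sets $E^0$ (vertices), $E^{\mathrm{st}}$ (structured edges), $E^1$ (edges), maps $s,r:E^{\mathrm{st}}\to E^0$ and a weight map $\omega:E^{\mathrm{st}}\to\mathbb N=\{1,2,\dots\}$ such that $E^1=\bigsqcup_{\alpha\in E^{\mathrm{st}}}\{\alpha_1,\dots,\alpha_{\omega(\alpha)}\}$. All weighted graphs are assumed row-finite: $s^{-1}(v)\subseteq E^{\mathrm{st}}$ is finite for every $v\in E^0$. A vertex $v$ is a sink if $s^{-1}(v)=\emptyset$; if $v$ is not a sink, $\omega(v):=\max\{\omega(\alpha)\mid\alpha\in s^{-1}(v)\}$. Rings of coefficients $R$ are unital. Let $(E^1)^*=\{\alpha_i^*\mid\alpha_i\in E^1\}$, $X=E^0\cup E^1\cup(E^1)^*$, and let $R\langle X\rangle$ be the free (non-unital) $R$-ring on $X$: the free left $R$-module on the nonempty words over $X$ with multiplication $(\sum r_xx)(\sum s_yy)=\sum r_xs_y\,xy$. The weighted Leavitt path algebra $L_R(E,\omega)$ is the quotient of $R\langle X\rangle$ by the ideal generated by the relations: (1) $vw=\delta_{vw}v$ for $v,w\in E^0$; (2) $s(\alpha)\alpha_i=\alpha_ir(\alpha)=\alpha_i$ and $r(\alpha)\alpha_i^*=\alpha_i^*s(\alpha)=\alpha_i^*$ for $\alpha\in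 E^{\mathrm{st}}$, $1\le i\le\omega(\alpha)$; (3) $\sum_{\alpha\in s^{-1}(v)}\alpha_i\alpha_j^*=\delta_{ij}v$ for every non-sink $v$ and $1\le i,j\le\omega(v)$; (4) $\sum_{1\le i\le\max\{\omega(\alpha),\omega(\beta)\}}\alpha_i^*\beta_i=\delta_{\alpha\beta}r(\alpha)$ for all $\alpha,\beta\in E^{\mathrm{st}}$; where in (3) and (4) $\alpha_i:=\alpha_i^*:=0$ whenever $i>\omega(\alpha)$. Grading: $L_R(E,\omega)$ is $\mathbb Z^n$-graded, $n=\max\{\omega(\alpha)\mid\alpha\in E^{\mathrm{st}}\}$ (if the weights are unbounded, $\mathbb Z^n$ is read as the free abelian group with basis $e_1,e_2,\dots$), by $\deg(v)=0$ for $v\in E^0$, $\deg(\alpha_i)=e_i$, $\deg(\alpha_i^* )=-e_i$, with $e_i$ the $i$-th standard basis vector. A generalised path is a single vertex $v$ (with $s(v)=r(v)=v$) or a word $x_1\cdots x_n$, $n\ge1$, $x_i\in E^1\cup(E^1)^*$ with $r(x_i)=s(x_{i+1})$, going from $s(x_1)$ to $r(x_n)$, where $s(\alpha_i)=s(\alpha)$, $r(\alpha_i)=r(\alpha)$, $s(\alpha_i^* )=r(\alpha)$, $r(\alpha_i^* )=s(\alpha)$. An LV-graph is a weighted graph such that $\omega(\alpha)\ge2$ for all $\alpha\in E^{\mathrm{st}}$; $|\{\alpha\in s^{-1}(v)\mid\omega(\alpha)=\omega(v)\}|\ge2$ for every non-sink $v\in E^0$; $E^{\mathrm{st}}\ne\emptyset$;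 and $(E,\omega)$ is connected, i.e. for any $u,v\in E^0$ there is a generalised path from $u$ to $v$. A ring $A$ is von Neumann regular if for every $a\in A$ there is $b\in A$ with $aba=a$; a graded ring $A$ is graded von Neumann regular if for every homogeneous $a\in A$ there is $b\in A$ with $aba=a$. *)

theory Defs
  imports "HOL-Library.Poly_Mapping" "HOL-Library.Countable_Set"
begin

section \<open>Rings that need not have a unit\<close>

record 'a nu_ring =
  carrier :: "'a set"
  add :: "'a \<Rightarrow> 'a \<Rightarrow> 'a"
  mult :: "'a \<Rightarrow> 'a \<Rightarrow> 'a"
  zero :: 'a

locale nu_ring =
  fixes A :: "'a nu_ring" (structure)
  assumes zero_closed: "zero A \<in> carrier A"
    and add_closed: "x \<in> carrier A \<Longrightarrow> y \<in> carrier A \<Longrightarrow> add A x y \<in> carrier A"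
    and mult_closed: "x \<in> carrier A \<Longrightarrow> y \<in> carrier A \<Longrightarrow> mult A x y \<in> carrier A"
    and add_assoc: "x \<in> carrier A \<Longrightarrow> y \<in> carrier A \<Longrightarrow> z \<in> carrier A \<Longrightarrow>
      add A (add A x y) z = add A x (add A y z)"
    and add_commute: "x \<in> carrier A \<Longrightarrow> y \<in> carrier A \<Longrightarrow> add A x y = add A y x"
    and add_zero: "x \<in> carrier A \<Longrightarrow> add A (zero A) x = x"
    and add_inverse: "x \<in> carrier A \<Longrightarrow> \<exists>y\<in>carrier A. add A x y = zero A"
    and mult_assoc: "x \<in> carrier A \<Longrightarrow> y \<in> carrier A \<Longrightarrow> z \<in> carrier A \<Longrightarrow>
      mult A (mult A x y) z = mult A x (mult A y z)"
    and distrib_left: "x \<in> carrier A \<Longrightarrow> y \<in> carrier A \<Longrightarrow> z \<in> carrier A \<Longrightarrow>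
      mult A x (add A y z) = add A (mult A x y) (mult A x z)"
    and distrib_right: "x \<in> carrier A \<Longrightarrow> y \<in> carrier A \<Longrightarrow> z \<in> carrier A \<Longrightarrow>
      mult A (add A x y) z = add A (mult A x z) (mult A y z)"

definition von_neumann_regular :: "'a nu_ring \<Rightarrow> bool" where
  "von_neumann_regular A \<longleftrightarrow>
    (\<forall>a\<in>carrier A. \<exists>b\<in>carrier A. mult A (mult A a b) a = a)"

text \<open>\<open>H d\<close> is the homogeneous component of degree \<open>d\<close>.\<close>
definition graded_von_neumann_regular :: "'a nu_ring \<Rightarrow> ('d \<Rightarrow> 'a set) \<Rightarrow> bool" where
  "graded_von_neumann_regular A H \<longleftrightarrow>
    (\<forall>d. \<forall>a\<in>H d. \<exists>b\<in>carrier A. mult A (mult A a b) a = a)"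

definition cong_rel :: "'a::ring set \<Rightarrow> 'a set \<Rightarrow> ('a \<times> 'a) set" where
  "cong_rel S I = {(x, y). x \<in> S \<and> y \<in> S \<and> x - y \<in> I}"

definition quotient_ring :: "'a::ring set \<Rightarrow> 'a set \<Rightarrow> 'a set nu_ring" where
  "quotient_ring S I =
    \<lparr> carrier = S // cong_rel S I,
      add = (\<lambda>P Q. \<Union>x\<in>P. \<Union>y\<in>Q. cong_rel S I `` {x + y}),
      mult = (\<lambda>P Q. \<Union>x\<in>P. \<Union>y\<in>Q. cong_rel S I `` {x * y}),
      zero = cong_rel S I `` {0} \<rparr>"

lemma equiv_cong_rel:
  fixes S I :: "'a::ring set"
  assumes I0: "0 \<in> I" and Iadd: "\<And>x y. x \<in> I \<Longrightarrow> y \<in> I \<Longrightarrow> x + y \<in> I"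
    and Iuminus: "\<And>x. x \<in> I \<Longrightarrow> - x \<in> I"
  shows "equiv S (cong_rel S I)"
proof (rule equivI)
  show "cong_rel S I \<subseteq> S \<times> S" by (auto simp: cong_rel_def)
  show "refl_on S (cong_rel S I)" using I0 by (auto simp: refl_on_def cong_rel_def)
  show "sym (cong_rel S I)"
    using Iuminus by (auto simp: sym_def cong_rel_def) (metis minus_diff_eq)
  show "trans (cong_rel S I)"
  proof (rule transI)
    fix x y z assume "(x, y) \<in> cong_rel S I" "(y, z) \<in> cong_rel S I"
    then show "(x, z) \<in> cong_rel S I" using Iadd[of "x - y" "y - z"] by (auto simp: cong_rel_def)
  qed
qed

lemma nu_ring_quotient_ring:
  fixes S I :: "'a::ring set"
  assumes S0: "0 \<in> S" and Sadd: "\<And>x y. x \<in> S \<Longrightarrow> y \<in> S \<Longrightarrow> x + y \<in> S"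
    and Suminus: "\<And>x. x \<in> S \<Longrightarrow> - x \<in> S"
    and Smult: "\<And>x y. x \<in> S \<Longrightarrow> y \<in> S \<Longrightarrow> x * y \<in> S"
    and I0: "0 \<in> I" and Iadd: "\<And>x y. x \<in> I \<Longrightarrow> y \<in> I \<Longrightarrow> x + y \<in> I"
    and Iuminus: "\<And>x. x \<in> I \<Longrightarrow> - x \<in> I"
    and Ileft: "\<And>x y. x \<in> S \<Longrightarrow> y \<in> I \<Longrightarrow> x * y \<in> I"
    and Iright: "\<And>x y. x \<in> I \<Longrightarrow> y \<in> S \<Longrightarrow> x * y \<in> I"
  shows "nu_ring (quotient_ring S I)"
    and "x \<in> S \<Longrightarrow> y \<in> S \<Longrightarrow> add (quotient_ring S I) (cong_rel S I `` {x}) (cong_rel S I `` {y})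
      = cong_rel S I `` {x + y}"
    and "x \<in> S \<Longrightarrow> y \<in> S \<Longrightarrow> mult (quotient_ring S I) (cong_rel S I `` {x}) (cong_rel S I `` {y})
      = cong_rel S I `` {x * y}"
proof -
  let ?r = "cong_rel S I" and ?Q = "quotient_ring S I"
  have eq: "equiv S ?r" using I0 Iadd Iuminus by (rule equiv_cong_rel)
  have rI: "(x, y) \<in> ?r \<longleftrightarrow> x \<in> S \<and> y \<in> S \<and> x - y \<in> I" for x y
    by (simp add: cong_rel_def)
  have cadd: "congruent2 ?r ?r (\<lambda>x y. ?r `` {x + y})"
  proof (rule congruent2I')
    fix x x' y y' assume "(x, x') \<in> ?r" "(y, y') \<in> ?r"
    then have "(x + y, x' + y') \<in> ?r"
      using Iadd[of "x - x'" "y - y'"] Sadd by (auto simp: rI algebra_simps)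
    then show "?r `` {x + y} = ?r `` {x' + y'}" using equiv_class_eq[OF eq] by blast
  qed
  have cmul: "congruent2 ?r ?r (\<lambda>x y. ?r `` {x * y})"
  proof (rule congruent2I')
    fix x x' y y' assume h: "(x, x') \<in> ?r" "(y, y') \<in> ?r"
    have "x * y - x' * y' = (x - x') * y + x' * (y - y')" by (simp add: algebra_simps)
    with h have "(x * y, x' * y') \<in> ?r"
      using Iadd Ileft Iright Smult by (simp add: rI)
    then show "?r `` {x * y} = ?r `` {x' * y'}" using equiv_class_eq[OF eq] by blast
  qed
  have add: "add ?Q (?r `` {x}) (?r `` {y}) = ?r `` {x + y}" if "x \<in> S" "y \<in> S" for x y
    using UN_equiv_class2[OF eq eq cadd that] by (simp add: quotient_ring_def)
  have mul: "mult ?Q (?r `` {x}) (?r `` {y}) = ?r `` {x * y}" if "x \<in> S" "y \<in> S" for x y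
    using UN_equiv_class2[OF eq eq cmul that] by (simp add: quotient_ring_def)
  have zero: "zero ?Q = ?r `` {0}" by (simp add: quotient_ring_def)
  have car: "P \<in> carrier ?Q \<longleftrightarrow> (\<exists>x\<in>S. P = ?r `` {x})" for P
    by (auto simp: quotient_ring_def quotient_def)
  show "nu_ring ?Q"
  proof
    fix x assume "x \<in> carrier ?Q"
    then obtain p where p: "p \<in> S" "x = ?r `` {p}" by (auto simp: car)
    then have "add ?Q x (?r `` {- p}) = zero ?Q" using Suminus by (simp add: add zero)
    then show "\<exists>y\<in>carrier ?Q. add ?Q x y = zero ?Q" using Suminus p(1) car by blast
  qed (use S0 Sadd Smult in \<open>auto simp: car add mul zero algebra_simps\<close>)
  show "x \<in> S \<Longrightarrow> y \<in> S \<Longrightarrow> add ?Q (?r `` {x}) (?r `` {y}) = ?r `` {x + y}" by (rule add)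
  show "x \<in> S \<Longrightarrow> y \<in> S \<Longrightarrow> mult ?Q (?r `` {x}) (?r `` {y}) = ?r `` {x * y}" by (rule mul)
qed


section \<open>Weighted graphs\<close>

record ('v, 'e) wgraph =
  verts :: "'v set"
  sedges :: "'e set"
  src :: "'e \<Rightarrow> 'v"
  rg :: "'e \<Rightarrow> 'v"
  wt :: "'e \<Rightarrow> nat"

definition out :: "('v, 'e) wgraph \<Rightarrow> 'v \<Rightarrow> 'e set" where
  "out G v = {a \<in> sedges G. src G a = v}"

definition sink :: "('v, 'e) wgraph \<Rightarrow> 'v \<Rightarrow> bool" where
  "sink G v \<longleftrightarrow> out G v = {}"

definition vwt :: "('v, 'e) wgraph \<Rightarrow> 'v \<Rightarrow> nat" where
  "vwt G v = Max (wt G ` out G v)"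

locale weighted_graph =
  fixes G :: "('v, 'e) wgraph"
  assumes countable_verts: "countable (verts G)"
    and countable_sedges: "countable (sedges G)"
    and src_in_verts: "a \<in> sedges G \<Longrightarrow> src G a \<in> verts G"
    and rg_in_verts: "a \<in> sedges G \<Longrightarrow> rg G a \<in> verts G"
    and wt_pos: "a \<in> sedges G \<Longrightarrow> 1 \<le> wt G a"
    and row_finite: "v \<in> verts G \<Longrightarrow> finite (out G v)"

text \<open>\<open>Ed a i\<close> and \<open>Gh a i\<close> stand for \<open>a\<^sub>i\<close> and \<open>a\<^sub>i\<^sup>*\<close>.\<close>
datatype ('v, 'e) gen = Ve 'v | Ed 'e nat | Gh 'e nat

definition edge_gens :: "('v, 'e) wgraph \<Rightarrow> ('v, 'e) gen set" where
  "edge_gens G =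
    {Ed a i | a i. a \<in> sedges G \<and> 1 \<le> i \<and> i \<le> wt G a} \<union>
    {Gh a i | a i. a \<in> sedges G \<and> 1 \<le> i \<and> i \<le> wt G a}"

definition gens :: "('v, 'e) wgraph \<Rightarrow> ('v, 'e) gen set" where
  "gens G = Ve ` verts G \<union> edge_gens G"

fun gen_src :: "('v, 'e) wgraph \<Rightarrow> ('v, 'e) gen \<Rightarrow> 'v" where
  "gen_src G (Ve v) = v"
| "gen_src G (Ed a i) = src G a"
| "gen_src G (Gh a i) = rg G a"

fun gen_rg :: "('v, 'e) wgraph \<Rightarrow> ('v, 'e) gen \<Rightarrow> 'v" where
  "gen_rg G (Ve v) = v"
| "gen_rg G (Ed a i) = rg G a"
| "gen_rg G (Gh a i) = src G a"

text \<open>\<open>gen_path G u xs v\<close>: the word \<open>xs\<close> is a generalised path from \<open>u\<close> to \<open>v\<close>; the empty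
  list represents the path consisting of a single vertex.\<close>
fun gen_path :: "('v, 'e) wgraph \<Rightarrow> 'v \<Rightarrow> ('v, 'e) gen list \<Rightarrow> 'v \<Rightarrow> bool" where
  "gen_path G u [] v \<longleftrightarrow> u \<in> verts G \<and> u = v"
| "gen_path G u (x # xs) v \<longleftrightarrow>
    x \<in> edge_gens G \<and> gen_src G x = u \<and> gen_path G (gen_rg G x) xs v"

locale LV_graph = weighted_graph +
  assumes wt_ge_2: "a \<in> sedges G \<Longrightarrow> 2 \<le> wt G a"
    and two_max_edges: "v \<in> verts G \<Longrightarrow> \<not> sink G v \<Longrightarrow>
      2 \<le> card {a \<in> out G v. wt G a = vwt G v}"
    and sedges_nonempty: "sedges G \<noteq> {}"
    and connected: "u \<in> verts G \<Longrightarrow> v \<in> verts G \<Longrightarrow> \<exists>xs. gen_path G u xs v"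


section \<open>The free ring on the generators\<close>

text \<open>Words form a monoid written additively, so that finitely supported functions on words,
  with their convolution product, form the free unital ring in which coefficients commute
  with the letters.  The wrapper avoids putting a monoid structure on lists.\<close>
datatype 'a word = Word (letters: "'a list")

instantiation word :: (type) monoid_add
begin

definition zero_word :: "'a word" where "0 = Word []"

definition plus_word :: "'a word \<Rightarrow> 'a word \<Rightarrow> 'a word" where
  "u + w = Word (letters u @ letters w)"

instance by standard (auto simp: zero_word_def plus_word_def)

end

text \<open>The non-unital subring spanned by the nonempty words over \<open>gens G\<close>.\<close>
definition free_carrier :: "('v, 'e) wgraph \<Rightarrow> (('v, 'e) gen word \<Rightarrow>\<^sub>0 'r::ring_1) set" where
  "free_carrier G =
    {p. \<forall>w\<in>Poly_Mapping.keys p. letters w \<noteq> [] \<and> set (letters w) \<subseteq> gens G}"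

definition scalar :: "'r::ring_1 \<Rightarrow> ('x word \<Rightarrow>\<^sub>0 'r)" where
  "scalar c = Poly_Mapping.single 0 c"

definition letter :: "'x \<Rightarrow> ('x word \<Rightarrow>\<^sub>0 'r::ring_1)" where
  "letter x = Poly_Mapping.single (Word [x]) 1"

definition vertex :: "'v \<Rightarrow> (('v, 'e) gen word \<Rightarrow>\<^sub>0 'r::ring_1)" where
  "vertex v = letter (Ve v)"

definition edge :: "('v, 'e) wgraph \<Rightarrow> 'e \<Rightarrow> nat \<Rightarrow> (('v, 'e) gen word \<Rightarrow>\<^sub>0 'r::ring_1)" where
  "edge G a i = (if i \<le> wt G a then letter (Ed a i) else 0)"

definition ghost :: "('v, 'e) wgraph \<Rightarrow> 'e \<Rightarrow> nat \<Rightarrow> (('v, 'e) gen word \<Rightarrow>\<^sub>0 'r::ring_1)" where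
  "ghost G a i = (if i \<le> wt G a then letter (Gh a i) else 0)"


section \<open>Weighted Leavitt path algebras\<close>

text \<open>\<open>p \<in> relators G\<close> means that \<open>p = 0\<close> is one of the defining relations.\<close>
inductive_set relators :: "('v, 'e) wgraph \<Rightarrow> (('v, 'e) gen word \<Rightarrow>\<^sub>0 'r::ring_1) set"
  for G :: "('v, 'e) wgraph" where
  vertices: "v \<in> verts G \<Longrightarrow> w \<in> verts G \<Longrightarrow>
    vertex v * vertex w - (if v = w then vertex v else 0) \<in> relators G"
| src_edge: "a \<in> sedges G \<Longrightarrow> 1 \<le> i \<Longrightarrow> i \<le> wt G a \<Longrightarrow>
    vertex (src G a) * edge G a i - edge G a i \<in> relators G"
| edge_rg: "a \<in> sedges G \<Longrightarrow> 1 \<le> i \<Longrightarrow> i \<le> wt G a \<Longrightarrow>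
    edge G a i * vertex (rg G a) - edge G a i \<in> relators G"
| rg_ghost: "a \<in> sedges G \<Longrightarrow> 1 \<le> i \<Longrightarrow> i \<le> wt G a \<Longrightarrow>
    vertex (rg G a) * ghost G a i - ghost G a i \<in> relators G"
| ghost_src: "a \<in> sedges G \<Longrightarrow> 1 \<le> i \<Longrightarrow> i \<le> wt G a \<Longrightarrow>
    ghost G a i * vertex (src G a) - ghost G a i \<in> relators G"
| edge_ghost: "v \<in> verts G \<Longrightarrow> \<not> sink G v \<Longrightarrow> i \<in> {1..vwt G v} \<Longrightarrow> j \<in> {1..vwt G v} \<Longrightarrow>
    (\<Sum>a\<in>out G v. edge G a i * ghost G a j) - (if i = j then vertex v else 0) \<in> relators G"
| ghost_edge: "a \<in> sedges G \<Longrightarrow> b \<in> sedges G \<Longrightarrow>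
    (\<Sum>i = 1..max (wt G a) (wt G b). ghost G a i * edge G b i)
      - (if a = b then vertex (rg G a) else 0) \<in> relators G"

text \<open>The ideal is taken in the category of \<open>R\<close>-rings.  Since the free ring has no unit, closure
  under scalars does not follow from closure under multiplication and is required separately.\<close>
inductive_set relator_ideal :: "('v, 'e) wgraph \<Rightarrow> (('v, 'e) gen word \<Rightarrow>\<^sub>0 'r::ring_1) set"
  for G :: "('v, 'e) wgraph" where
  relator: "p \<in> relators G \<Longrightarrow> p \<in> relator_ideal G"
| zero: "0 \<in> relator_ideal G"
| add: "p \<in> relator_ideal G \<Longrightarrow> q \<in> relator_ideal G \<Longrightarrow> p + q \<in> relator_ideal G"
| scalar_left: "p \<in> relator_ideal G \<Longrightarrow> scalar c * p \<in> relator_ideal G"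
| scalar_right: "p \<in> relator_ideal G \<Longrightarrow> p * scalar c \<in> relator_ideal G"
| mult_left: "p \<in> relator_ideal G \<Longrightarrow> q \<in> free_carrier G \<Longrightarrow> q * p \<in> relator_ideal G"
| mult_right: "p \<in> relator_ideal G \<Longrightarrow> q \<in> free_carrier G \<Longrightarrow> p * q \<in> relator_ideal G"

definition leavitt ::
  "'r::ring_1 itself \<Rightarrow> ('v, 'e) wgraph \<Rightarrow> (('v, 'e) gen word \<Rightarrow>\<^sub>0 'r) set nu_ring" where
  "leavitt _ G = quotient_ring (free_carrier G) (relator_ideal G)"

text \<open>Degrees live in the free abelian group on \<open>e\<^sub>i\<close> for all natural numbers \<open>i\<close>, which
  contains \<open>\<int>\<^sup>n\<close>; components of degrees outside the span of \<open>e\<^sub>1, e\<^sub>2, \<dots>\<close>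
  (up to \<open>e\<^sub>n\<close>, if the weights are bounded by \<open>n\<close>) are zero.\<close>
fun gen_deg :: "('v, 'e) gen \<Rightarrow> (nat \<Rightarrow>\<^sub>0 int)" where
  "gen_deg (Ve v) = 0"
| "gen_deg (Ed a i) = Poly_Mapping.single i 1"
| "gen_deg (Gh a i) = - Poly_Mapping.single i 1"

definition word_deg :: "('v, 'e) gen word \<Rightarrow> (nat \<Rightarrow>\<^sub>0 int)" where
  "word_deg w = sum_list (map gen_deg (letters w))"

definition leavitt_component ::
  "'r::ring_1 itself \<Rightarrow> ('v, 'e) wgraph \<Rightarrow> (nat \<Rightarrow>\<^sub>0 int) \<Rightarrow>
    (('v, 'e) gen word \<Rightarrow>\<^sub>0 'r) set set" where
  "leavitt_component _ G d =
    {cong_rel (free_carrier G) (relator_ideal G) `` {p} | p.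
      p \<in> free_carrier G \<and> (\<forall>w\<in>Poly_Mapping.keys p. word_deg w = d)}"

lemma keys_mult_word:
  "w \<in> Poly_Mapping.keys (p * q) \<Longrightarrow>
    \<exists>u v. w = u + v \<and> u \<in> Poly_Mapping.keys p \<and> v \<in> Poly_Mapping.keys q"
  for p q :: "'x word \<Rightarrow>\<^sub>0 'r::ring_1"
  using keys_mult[of p q] by blast

lemma free_carrier_closed:
  "0 \<in> free_carrier G"
  "p \<in> free_carrier G \<Longrightarrow> q \<in> free_carrier G \<Longrightarrow> p + q \<in> free_carrier G"
  "p \<in> free_carrier G \<Longrightarrow> - p \<in> free_carrier G"
  "p \<in> free_carrier G \<Longrightarrow> q \<in> free_carrier G \<Longrightarrow> p * q \<in> free_carrier G"
proof -
  show "p \<in> free_carrier G \<Longrightarrow> q \<in> free_carrier G \<Longrightarrow> p * q \<in> free_carrier G"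
    unfolding free_carrier_def
    by (fastforce dest: keys_mult_word simp: plus_word_def)
qed (use Poly_Mapping.keys_add in \<open>fastforce simp: free_carrier_def\<close>)+

lemma relator_ideal_uminus: "p \<in> relator_ideal G \<Longrightarrow> - p \<in> relator_ideal G"
proof -
  assume "p \<in> relator_ideal G"
  then have "scalar (- 1) * p \<in> relator_ideal G" by (rule relator_ideal.scalar_left)
  then show ?thesis by (simp add: scalar_def single_uminus)
qed

theorem nu_ring_leavitt: "nu_ring (leavitt TYPE('r::ring_1) G)"
  unfolding leavitt_def
  by (rule nu_ring_quotient_ring)
    (auto intro: free_carrier_closed relator_ideal_uminus relator_ideal.intros)

end

theory Submission
  imports Defs "HOL-Library.Function_Algebras" "HOL-Library.Product_Plus"
begin

text \<open>Take two edges \<open>a0\<close>, \<open>b0\<close> of maximal weight with the same source. Since every weight is at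
  least 2, the algebra acts on functions on vertices times naturals by partial bijections in such a
  way that \<open>(a0)\<^sub>1\<close> acts as zero while \<open>(b0)\<^sub>1\<close> does not. Over the dual numbers this action can
  be deformed: \<open>(a0)\<^sub>i\<close> is increased by \<open>\<epsilon> (b0)\<^sub>i \<tau>\<close> and \<open>(b0)\<^sub>i\<^sup>*\<close> decreased by \<open>\<epsilon> \<tau> (a0)\<^sub>i\<^sup>*\<close>,
  where \<open>\<tau>\<close> identifies the component at the range of \<open>a0\<close> with the one at the range of \<open>b0\<close>.
  Now \<open>x = (a0)\<^sub>1\<close> acts as a nonzero multiple of \<open>\<epsilon>\<close>, so \<open>x y x\<close> acts as zero for every \<open>y\<close>,
  and the homogeneous element \<open>x\<close> is not regular.\<close>

section \<open>Modules over the free ring\<close>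

lemma poly_mapping_single_induct [case_names zero single_add]:
  fixes p :: "'a \<Rightarrow>\<^sub>0 'b::monoid_add"
  assumes zero: "P 0" and single_add: "\<And>k c p. P p \<Longrightarrow> P (p + Poly_Mapping.single k c)"
  shows "P p"
proof (induction p rule: update_induct)
  case const
  show ?case by (rule zero)
next
  case (update p k c)
  have "Poly_Mapping.update k c p = p + Poly_Mapping.single k c"
    using update(1) by (intro poly_mapping_eqI)
      (auto simp: lookup_update lookup_add lookup_single when_def in_keys_iff)
  then show ?case using single_add[OF update(3)] by simp
qed

text \<open>Letters act linearly over the coefficients because the two commute in the free ring.
  Coefficients need not commute among themselves, so a polynomial is only shown to act
  additively.\<close>

locale word_action =
  fixes scale :: "'r::ring_1 \<Rightarrow> 'm::ab_group_add \<Rightarrow> 'm" and act :: "'x \<Rightarrow> 'm \<Rightarrow> 'm"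
  assumes scale_right_add: "scale c (m + n) = scale c m + scale c n"
    and scale_left_add: "scale (c + d) m = scale c m + scale d m"
    and scale_scale: "scale c (scale d m) = scale (c * d) m"
    and scale_one: "scale 1 m = m"
    and act_add: "act x (m + n) = act x m + act x n"
    and act_scale: "act x (scale c m) = scale c (act x m)"
begin

definition word_act :: "'x word \<Rightarrow> 'm \<Rightarrow> 'm" where
  "word_act w = foldr act (letters w)"

definition poly_act :: "('x word \<Rightarrow>\<^sub>0 'r) \<Rightarrow> 'm \<Rightarrow> 'm" where
  "poly_act p m = (\<Sum>w\<in>Poly_Mapping.keys p. scale (Poly_Mapping.lookup p w) (word_act w m))"

lemma scale_zero_left [simp]: "scale 0 m = 0"
  using scale_left_add[of 0 0 m] by simp

lemma word_act_plus: "word_act (u + w) m = word_act u (word_act w m)"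
  by (simp add: word_act_def plus_word_def)

lemma word_act_add: "word_act w (m + n) = word_act w m + word_act w n"
proof -
  have "foldr act xs (m + n) = foldr act xs m + foldr act xs n" for xs
    by (induction xs) (simp_all add: act_add)
  then show ?thesis by (simp add: word_act_def)
qed

lemma word_act_scale: "word_act w (scale c m) = scale c (word_act w m)"
proof -
  have "foldr act xs (scale c m) = scale c (foldr act xs m)" for xs
    by (induction xs) (simp_all add: act_scale)
  then show ?thesis by (simp add: word_act_def)
qed

lemma poly_act_superset:
  assumes "finite A" "Poly_Mapping.keys p \<subseteq> A"
  shows "poly_act p m = (\<Sum>w\<in>A. scale (Poly_Mapping.lookup p w) (word_act w m))"
  unfolding poly_act_def using assms
  by (intro sum.mono_neutral_left) (auto simp: in_keys_iff)

lemma poly_act_plus: "poly_act (p + q) m = poly_act p m + poly_act q m"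
proof -
  let ?A = "Poly_Mapping.keys p \<union> Poly_Mapping.keys q"
  have "poly_act r m = (\<Sum>w\<in>?A. scale (Poly_Mapping.lookup r w) (word_act w m))"
    if "Poly_Mapping.keys r \<subseteq> ?A" for r
    using that by (intro poly_act_superset) simp_all
  then show ?thesis
    using Poly_Mapping.keys_add[of p q]
    by (simp add: lookup_add scale_left_add sum.distrib)
qed

lemma poly_act_zero [simp]: "poly_act 0 m = 0"
  by (simp add: poly_act_def)

lemma poly_act_minus: "poly_act (p - q) m = poly_act p m - poly_act q m"
  using poly_act_plus[of "p - q" q m] by simp

lemma poly_act_sum: "poly_act (\<Sum>i\<in>A. f i) m = (\<Sum>i\<in>A. poly_act (f i) m)"
  by (induction A rule: infinite_finite_induct) (simp_all add: poly_act_plus)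

lemma poly_act_single: "poly_act (Poly_Mapping.single w c) m = scale c (word_act w m)"
  by (cases "c = 0") (simp_all add: poly_act_def)

lemma poly_act_add: "poly_act p (m + n) = poly_act p m + poly_act p n"
  by (simp add: poly_act_def word_act_add scale_right_add sum.distrib)

lemma poly_act_zero_right [simp]: "poly_act p 0 = 0"
  using poly_act_add[of p 0 0] by simp

lemma poly_act_letter: "poly_act (letter x) m = act x m"
  by (simp add: letter_def poly_act_single scale_one word_act_def)

text \<open>Both sides are additive in \<open>p\<close> and in \<open>q\<close>, so monomials
  suffice; there the scalar of \<open>q\<close> passes through the word of \<open>p\<close>.\<close>

lemma poly_act_mult: "poly_act (p * q) m = poly_act p (poly_act q m)"
proof (induction p rule: poly_mapping_single_induct)
  case (single_add u c p)
  have "poly_act (Poly_Mapping.single u c * q) m = poly_act (Poly_Mapping.single u c) (poly_act q m)"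
    by (induction q rule: poly_mapping_single_induct)
      (simp_all add: distrib_left poly_act_plus poly_act_add mult_single poly_act_single
        word_act_plus word_act_scale scale_scale)
  with single_add show ?case by (simp add: distrib_right poly_act_plus)
qed simp

lemma poly_act_invariant:
  assumes "0 \<in> N" "\<And>m n. m \<in> N \<Longrightarrow> n \<in> N \<Longrightarrow> m + n \<in> N"
    and "\<And>c m. m \<in> N \<Longrightarrow> scale c m \<in> N" "\<And>x m. m \<in> N \<Longrightarrow> act x m \<in> N"
    and "m \<in> N"
  shows "poly_act p m \<in> N"
proof (induction p rule: poly_mapping_single_induct)
  case (single_add w c p)
  have "foldr act xs m \<in> N" for xs
    by (induction xs) (simp_all add: assms)
  with single_add show ?case by (simp add: assms poly_act_plus poly_act_single word_act_def)
qed (simp add: assms)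

end

text \<open>The elements annihilating a module form a two-sided ideal. For \<open>p * q\<close> the
  induction hypothesis is needed at the vector \<open>poly_act q m\<close>, so \<open>m\<close>
  stays arbitrary.\<close>

lemma poly_act_relator_ideal:
  fixes act :: "('v, 'e) gen \<Rightarrow> 'm::ab_group_add \<Rightarrow> 'm" and scale :: "'r::ring_1 \<Rightarrow> 'm \<Rightarrow> 'm"
  assumes "word_action scale act"
    and rel: "\<And>q m. q \<in> relators G \<Longrightarrow> word_action.poly_act scale act q m = 0"
    and "p \<in> relator_ideal G"
  shows "word_action.poly_act scale act p m = 0"
proof -
  interpret word_action scale act by fact
  from assms(3) show ?thesis
    by (induction arbitrary: m) (simp_all add: rel poly_act_plus poly_act_mult)
qed


section \<open>Distributing infinitely many copies\<close>

text \<open>Rows and columns of \<open>S\<close> are finite and nonempty, so each of them times the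
  naturals is countably infinite. Hence \<open>P \<times> UNIV\<close> and
  \<open>Q \<times> UNIV\<close> both biject with \<open>S\<close> times the naturals.\<close>

lemma bij_betw_copies:
  fixes S :: "('a \<times> 'b) set"
  assumes "finite P" "finite Q" and S: "S \<subseteq> P \<times> Q"
    and P: "\<And>a. a \<in> P \<Longrightarrow> \<exists>i. (a, i) \<in> S" and Q: "\<And>i. i \<in> Q \<Longrightarrow> \<exists>a. (a, i) \<in> S"
  obtains t :: "'a \<Rightarrow> nat \<Rightarrow> 'b \<times> nat"
  where "bij_betw (\<lambda>(a, k). t a k) (P \<times> UNIV) (Q \<times> UNIV)"
    and "\<And>a. a \<in> P \<Longrightarrow> fst ` range (t a) = {i. (a, i) \<in> S}"
proof -
  let ?R = "\<lambda>a. {i. (a, i) \<in> S} \<times> (UNIV :: nat set)"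
  let ?C = "\<lambda>i. {a. (a, i) \<in> S} \<times> (UNIV :: nat set)"
  have fin: "finite {i. (a, i) \<in> S}" "finite {a. (a, i) \<in> S}" for a i
    using assms(1,2) S by (auto intro: finite_subset[of _ P] finite_subset[of _ Q])
  then have cnt: "countable (?R a)" "countable (?C i)" for a i
    by (simp_all add: countable_finite countable_SIGMA)
  \<comment> \<open>\<open>g a\<close> spreads the copies of \<open>a\<close> over its row;
    \<open>h i\<close> renumbers by single naturals whatever arrives in column
    \<open>i\<close>.\<close>
  define g where "g a = from_nat_into (?R a)" for a
  define h where "h i = to_nat_on (?C i)" for i
  have g: "bij_betw (g a) UNIV (?R a)" if "a \<in> P" for a
    unfolding g_def using P[OF that]
    by (intro bij_betw_from_nat_into cnt) (auto simp: finite_cartesian_product_iff)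
  have h: "bij_betw (h i) (?C i) UNIV" if "i \<in> Q" for i
    unfolding h_def using Q[OF that]
    by (intro to_nat_on_infinite cnt) (auto simp: finite_cartesian_product_iff)
  define t where "t a k = (fst (g a k), h (fst (g a k)) (a, snd (g a k)))" for a k
  let ?M = "{(a, i, m). (a, i) \<in> S}"
  have 1: "bij_betw (\<lambda>(a, k). (a, g a k)) (P \<times> UNIV) ?M"
    unfolding bij_betw_def
  proof
    show "inj_on (\<lambda>(a, k). (a, g a k)) (P \<times> UNIV)"
      using g by (auto simp: inj_on_def bij_betw_def)
    show "(\<lambda>(a, k). (a, g a k)) ` (P \<times> UNIV) = ?M"
    proof safe
      fix a k i m assume "a \<in> P" "(i, m) = g a k"
      then show "(a, i) \<in> S" using bij_betwE[OF g, of a] by (metis SigmaD1 UNIV_I mem_Collect_eq)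
    next
      fix a i m assume a: "(a, i) \<in> S"
      then have "a \<in> P" using S by auto
      then have "(i, m) \<in> range (g a)" using g a by (auto simp: bij_betw_def)
      then show "(a, i, m) \<in> (\<lambda>(a, k). (a, g a k)) ` (P \<times> UNIV)" using \<open>a \<in> P\<close> by force
    qed
  qed
  have 2: "bij_betw (\<lambda>(a, i, m). (i, h i (a, m))) ?M (Q \<times> UNIV)"
    unfolding bij_betw_def
  proof
    show "inj_on (\<lambda>(a, i, m). (i, h i (a, m))) ?M"
    proof (rule inj_onI, clarsimp)
      fix a m b n i assume ab: "(a, i) \<in> S" "(b, i) \<in> S" and eq: "h i (a, m) = h i (b, n)"
      then have "i \<in> Q" using S by auto
      then show "a = b \<and> m = n"
        using inj_onD[OF bij_betw_imp_inj_on[OF h] eq] ab by auto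
    qed
    show "(\<lambda>(a, i, m). (i, h i (a, m))) ` ?M = Q \<times> UNIV"
    proof safe
      fix i l assume "i \<in> Q"
      then have "l \<in> h i ` ?C i" using h by (auto simp: bij_betw_def)
      then show "(i, l) \<in> (\<lambda>(a, i, m). (i, h i (a, m))) ` ?M" by force
    qed (use S in auto)
  qed
  show ?thesis
  proof
    have "(\<lambda>(a, k). t a k) = (\<lambda>(a, i, m). (i, h i (a, m))) \<circ> (\<lambda>(a, k). (a, g a k))"
      by (auto simp: t_def split: prod.split)
    then show "bij_betw (\<lambda>(a, k). t a k) (P \<times> UNIV) (Q \<times> UNIV)"
      using bij_betw_trans[OF 1 2] by simp
    fix a assume "a \<in> P"
    have "fst ` range (t a) = fst ` range (g a)" by (auto simp: t_def image_iff)
    also have "\<dots> = {i. (a, i) \<in> S}" using g[OF \<open>a \<in> P\<close>] by (auto simp: bij_betw_def)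
    finally show "fst ` range (t a) = {i. (a, i) \<in> S}" .
  qed
qed


section \<open>The twisted module\<close>

text \<open>A matrix unit on components: for \<open>v = w\<close> the projection onto a component,
  and from \<open>rg G a0\<close> to \<open>rg G b0\<close> the map \<tau> of the
  deformation.\<close>

definition transport :: "'v \<Rightarrow> 'v \<Rightarrow> ('v \<Rightarrow> nat \<Rightarrow> 'r) \<Rightarrow> 'v \<Rightarrow> nat \<Rightarrow> 'r::ring_1" where
  "transport v w f = (\<lambda>u k. if u = v then f w k else 0)"

text \<open>An injective \<open>t\<close> splits the coordinates at \<open>w\<close> by the first
  entry of \<open>t k\<close>; \<open>push\<close> and \<open>pull\<close> are the partial bijection
  on the piece of index \<open>i\<close> and its transpose. \<open>inv t\<close> is evaluated only
  on the range of \<open>t\<close>.\<close>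

definition push ::
  "(nat \<Rightarrow> nat \<times> nat) \<Rightarrow> 'v \<Rightarrow> 'v \<Rightarrow> nat \<Rightarrow> ('v \<Rightarrow> nat \<Rightarrow> 'r) \<Rightarrow> 'v \<Rightarrow> nat \<Rightarrow> 'r::ring_1" where
  "push t v w i f = (\<lambda>u l. if u = v \<and> (i, l) \<in> range t then f w (inv t (i, l)) else 0)"

definition pull ::
  "(nat \<Rightarrow> nat \<times> nat) \<Rightarrow> 'v \<Rightarrow> 'v \<Rightarrow> nat \<Rightarrow> ('v \<Rightarrow> nat \<Rightarrow> 'r) \<Rightarrow> 'v \<Rightarrow> nat \<Rightarrow> 'r::ring_1" where
  "pull t v w i f = (\<lambda>u k. if u = w \<and> fst (t k) = i then f v (snd (t k)) else 0)"

lemma sum_apply2: "(\<Sum>i\<in>A. f i) u k = (\<Sum>i\<in>A. f i u k)"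
  for f :: "'i \<Rightarrow> 'v \<Rightarrow> nat \<Rightarrow> 'r::ring_1"
  by (induction A rule: infinite_finite_induct) auto

text \<open>The composite for \<open>i\<close> is the part of the transport on those
  \<open>k\<close> with \<open>fst (t k) = i\<close>, and these parts tile all coordinates.\<close>

lemma sum_pull_push:
  assumes "inj t" "finite A" "\<And>k. fst (t k) \<in> A"
  shows "(\<Sum>i\<in>A. pull t v w i (push t v w' i f)) = transport w w' f"
proof (intro ext)
  fix u k
  have "pull t v w i (push t v w' i f) u k =
      (if i = fst (t k) then transport w w' f u k else 0)" for i
    using assms(1) by (auto simp: pull_def push_def transport_def)
  then show "(\<Sum>i\<in>A. pull t v w i (push t v w' i f)) u k = transport w w' f u k"
    using assms by (simp add: sum_apply2)
qed

lemma pull_push_disjoint: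
  assumes "v \<noteq> v' \<or> range t \<inter> range t' = {}"
  shows "pull t v w i (push t' v' w' i f) = 0"
  using assms by (force simp: pull_def push_def fun_eq_iff disjoint_iff simp del: split_paired_All)

text \<open>\<open>pull\<close> with \<open>j\<close> writes only where the first entry is
  \<open>j\<close>, and \<open>push\<close> with \<open>i\<close> reads only where it is
  \<open>i\<close>. For \<open>i = j\<close> a coordinate projection at \<open>v\<close>
  survives.\<close>

lemma push_pull:
  assumes "inj t"
  shows "push t v w i (pull t v w j f) =
    (\<lambda>u l. if u = v \<and> i = j \<and> (i, l) \<in> range t then f v l else 0)"
  using assms by (auto simp: pull_def push_def fun_eq_iff f_inv_into_f)

text \<open>The middle component is written and at once read back, so its name cancels. Thus the
  corrections at \<open>a0\<close> and \<open>b0\<close> match even if the two ranges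
  differ.\<close>

lemma push_pull_independent: "push t v w i (pull t' v' w j f) = push t v w' i (pull t' v' w' j f)"
  by (simp add: push_def pull_def cong: if_cong)

lemma linear_ops:
  "transport v w (f + g) = transport v w f + transport v w g"
  "push t v w i (f + g) = push t v w i f + push t v w i g"
  "pull t v w i (f + g) = pull t v w i f + pull t v w i g"
  "transport v w (- f) = - transport v w f"
  "push t v w i (- f) = - push t v w i f" "pull t v w i (- f) = - pull t v w i f"
  "push t v w i 0 = 0" "pull t v w i 0 = 0" "transport v w 0 = 0"
  by (auto simp: transport_def push_def pull_def fun_eq_iff)

lemma transport_ops:
  "transport v w (transport v' w' f) = (if w = v' then transport v w' f else 0)"
  "transport u u (push t v w i f) = (if u = v then push t v w i f else 0)"
  "push t v w i (transport u u f) = (if u = w then push t v w i f else 0)"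
  "transport u u (pull t v w i f) = (if u = w then pull t v w i f else 0)"
  "pull t v w i (transport u u f) = (if u = v then pull t v w i f else 0)"
  by (auto simp: transport_def push_def pull_def fun_eq_iff)

text \<open>\<open>t a k = (i, l)\<close> means that \<open>a\<^sub>i\<close> carries the \<open>k\<close>-th coordinate at the range of \<open>a\<close> to the
  \<open>l\<close>-th coordinate at its source.\<close>
locale twisted_graph = weighted_graph G for G :: "('v, 'e) wgraph" +
  fixes t :: "'e \<Rightarrow> nat \<Rightarrow> nat \<times> nat" and a0 b0 :: 'e
  assumes bij_t: "v \<in> verts G \<Longrightarrow> \<not> sink G v \<Longrightarrow>
      bij_betw (\<lambda>(a, k). t a k) (out G v \<times> UNIV) ({1..vwt G v} \<times> UNIV)"
    and t_le: "a \<in> sedges G \<Longrightarrow> fst (t a k) \<le> wt G a"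
    and a0: "a0 \<in> sedges G" and b0: "b0 \<in> sedges G" and a0_neq_b0: "a0 \<noteq> b0"
    and src_eq: "src G b0 = src G a0" and wt_eq: "wt G b0 = wt G a0"
begin

fun base :: "('v, 'e) gen \<Rightarrow> ('v \<Rightarrow> nat \<Rightarrow> 'r::ring_1) \<Rightarrow> 'v \<Rightarrow> nat \<Rightarrow> 'r" where
  "base (Ve v) f = transport v v f"
| "base (Ed a i) f = push (t a) (src G a) (rg G a) i f"
| "base (Gh a i) f = pull (t a) (src G a) (rg G a) i f"

text \<open>The factor \<tau> is absorbed into the component arguments: the push along
  \<open>t b0\<close> reads at \<open>rg G a0\<close>, and the pull along \<open>t a0\<close> writes
  at \<open>rg G b0\<close>.\<close>

fun twist :: "('v, 'e) gen \<Rightarrow> ('v \<Rightarrow> nat \<Rightarrow> 'r::ring_1) \<Rightarrow> 'v \<Rightarrow> nat \<Rightarrow> 'r" where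
  "twist (Ve v) f = 0"
| "twist (Ed a i) f = (if a = a0 then push (t b0) (src G a0) (rg G a0) i f else 0)"
| "twist (Gh a i) f = (if a = b0 then - pull (t a0) (src G a0) (rg G b0) i f else 0)"

text \<open>A pair \<open>(f, g)\<close> stands for f + \<epsilon> g; a twist of \<open>g\<close>
  would carry the square of \<epsilon>.\<close>

definition act :: "('v, 'e) gen \<Rightarrow> ('v \<Rightarrow> nat \<Rightarrow> 'r::ring_1) \<times> ('v \<Rightarrow> nat \<Rightarrow> 'r) \<Rightarrow>
    ('v \<Rightarrow> nat \<Rightarrow> 'r) \<times> ('v \<Rightarrow> nat \<Rightarrow> 'r)" where
  "act x = (\<lambda>(f, g). (base x f, base x g + twist x f))"

definition scale :: "'r::ring_1 \<Rightarrow> ('v \<Rightarrow> nat \<Rightarrow> 'r) \<times> ('v \<Rightarrow> nat \<Rightarrow> 'r) \<Rightarrow>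
    ('v \<Rightarrow> nat \<Rightarrow> 'r) \<times> ('v \<Rightarrow> nat \<Rightarrow> 'r)" where
  "scale c = (\<lambda>(f, g). (\<lambda>v k. c * f v k, \<lambda>v k. c * g v k))"

sublocale word_action scale act
proof
  show "act x (m + n) = act x m + act x n" for x m n
    by (cases x; cases m; cases n) (simp_all add: act_def linear_ops algebra_simps)
  show "act x (scale c m) = scale c (act x m)" for x c m
    by (cases x; cases m)
      (auto simp: act_def scale_def transport_def push_def pull_def fun_eq_iff algebra_simps)
qed (auto simp: scale_def fun_eq_iff algebra_simps)

section \<open>Relations for the undeformed action\<close>

lemma inj_t: "a \<in> sedges G \<Longrightarrow> inj (t a)"
proof (rule injI)
  fix k l assume a: "a \<in> sedges G" and "t a k = t a l"
  have "a \<in> out G (src G a)" using a by (simp add: out_def)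
  moreover from this have "inj_on (\<lambda>(a, k). t a k) (out G (src G a) \<times> UNIV)"
    using bij_t[of "src G a"] src_in_verts[OF a] by (auto simp: sink_def bij_betw_def)
  ultimately show "k = l"
    using \<open>t a k = t a l\<close> inj_onD[of _ _ "(a, k)" "(a, l)"] by fastforce
qed

lemma range_t_disjoint:
  assumes "a \<in> sedges G" "b \<in> sedges G" "a \<noteq> b" "src G a = src G b"
  shows "range (t a) \<inter> range (t b) = {}"
proof -
  have ab: "a \<in> out G (src G a)" "b \<in> out G (src G a)" using assms by (simp_all add: out_def)
  then have "inj_on (\<lambda>(a, k). t a k) (out G (src G a) \<times> UNIV)"
    using bij_t[of "src G a"] src_in_verts assms by (auto simp: sink_def bij_betw_def)
  then have "t a k \<noteq> t b l" for k l using inj_onD[of _ _ "(a, k)" "(b, l)"] ab assms(3) by fastforce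
  then show ?thesis by blast
qed

lemma t_pos: "a \<in> sedges G \<Longrightarrow> 1 \<le> fst (t a k)"
proof -
  assume a: "a \<in> sedges G"
  then have o: "a \<in> out G (src G a)" by (simp add: out_def)
  then have "bij_betw (\<lambda>(a, k). t a k) (out G (src G a) \<times> UNIV) ({1..vwt G (src G a)} \<times> UNIV)"
    using bij_t[of "src G a"] src_in_verts[OF a] by (auto simp: sink_def)
  from bspec[OF bij_betwE[OF this], of "(a, k)"] o
  have "t a k \<in> {1..vwt G (src G a)} \<times> UNIV" by simp
  then show ?thesis by (auto simp: mem_Times_iff)
qed

text \<open>\<open>w\<close> and \<open>w'\<close> are free so that correction terms, which mix the
  ranges of \<open>a0\<close> and \<open>b0\<close>, are covered too. For \<open>a = b\<close> the
  bound \<open>N\<close> captures every first entry of \<open>t a\<close>.\<close>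

lemma pull_push_edges:
  assumes "a \<in> sedges G" "b \<in> sedges G" "wt G a \<le> N"
  shows "(\<Sum>i = 1..N. pull (t a) (src G a) w i (push (t b) (src G b) w' i f)) =
    (if a = b then transport w w' f else 0)"
proof (cases "a = b")
  case True
  have N: "fst (t a k) \<in> {1..N}" for k
    using t_pos[OF assms(1)] t_le[OF assms(1), of k] assms(3) by auto
  show ?thesis
    using True sum_pull_push[OF inj_t[OF assms(1)] finite_atLeastAtMost N] by simp
next
  case False
  then show ?thesis
    using range_t_disjoint[OF assms(1,2)] by (simp add: pull_push_disjoint)
qed

text \<open>By the bijection at \<open>v\<close>, each position \<open>(i, l)\<close> is hit by
  exactly one outgoing edge, so a single summand contributes.\<close>

lemma sum_push_pull:
  assumes v: "v \<in> verts G" "\<not> sink G v" and i: "i \<in> {1..vwt G v}"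
  shows "(\<Sum>a\<in>out G v. push (t a) (src G a) (rg G a) i (pull (t a) (src G a) (rg G a) j f)) =
    (if i = j then transport v v f else 0)"
proof (intro ext)
  fix u l
  have "(i, l) \<in> (\<lambda>(a, k). t a k) ` (out G v \<times> UNIV)"
    using bij_betw_imp_surj_on[OF bij_t[OF v]] i by simp
  then obtain a where a: "a \<in> out G v" "(i, l) \<in> range (t a)" by force
  have "push (t b) (src G b) (rg G b) i (pull (t b) (src G b) (rg G b) j f) u l =
      (if b = a then if u = v \<and> i = j then f v l else 0 else 0)" if "b \<in> out G v" for b
  proof -
    have "b \<in> sedges G" "src G b = v" "a \<in> sedges G" "src G a = v"
      using that a by (auto simp: out_def)
    moreover from this have "(i, l) \<in> range (t b) \<longleftrightarrow> b = a"
      using range_t_disjoint[of a b] a by blast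
    ultimately show ?thesis by (simp add: push_pull inj_t)
  qed
  then show "(\<Sum>a\<in>out G v. push (t a) (src G a) (rg G a) i (pull (t a) (src G a) (rg G a) j f)) u l
      = (if i = j then transport v v f else 0) u l"
    using a row_finite[OF v(1)] by (simp add: sum_apply2 transport_def)
qed

section \<open>Relations for the deformed action\<close>

lemma push_eq_0:
  assumes "a \<in> sedges G" "wt G a < i"
  shows "push (t a) v w i f = 0"
proof -
  have "(i, l) \<notin> range (t a)" for l
    using t_le[OF assms(1)] assms(2) by (metis fst_conv leD rangeE)
  then show ?thesis by (simp add: push_def fun_eq_iff)
qed

lemma pull_eq_0:
  assumes "a \<in> sedges G" "wt G a < i"
  shows "pull (t a) v w i f = 0"
proof -
  have "fst (t a k) \<noteq> i" for k
    using t_le[OF assms(1), of k] assms(2) by simp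
  then show ?thesis by (simp add: pull_def fun_eq_iff)
qed

text \<open>Beyond the weight \<open>edge G a i\<close> is 0, so the letter must act as zero too.
  For \<open>a0\<close> the correction uses \<open>t b0\<close>, which vanishes there because the
  weights agree.\<close>

lemma poly_act_edge: "a \<in> sedges G \<Longrightarrow> poly_act (edge G a i) m = act (Ed a i) m"
  by (cases m) (auto simp: edge_def poly_act_letter act_def push_eq_0 b0 wt_eq zero_prod_def)

lemma poly_act_ghost: "a \<in> sedges G \<Longrightarrow> poly_act (ghost G a i) m = act (Gh a i) m"
  by (cases m) (auto simp: ghost_def poly_act_letter act_def pull_eq_0 a0 wt_eq zero_prod_def)

lemma poly_act_vertex: "poly_act (vertex v) m = act (Ve v) m"
  by (simp add: vertex_def poly_act_letter)

text \<open>The undeformed parts give the relation. In the product rule for the \<epsilon>-part only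
  \<open>a0\<close> and \<open>b0\<close> contribute, with opposite signs.\<close>

lemma edge_ghost_act:
  assumes v: "v \<in> verts G" "\<not> sink G v" and i: "i \<in> {1..vwt G v}"
  shows "(\<Sum>a\<in>out G v. act (Ed a i) (act (Gh a j) m)) = (if i = j then act (Ve v) m else 0)"
proof -
  obtain f g where m: "m = (f, g)" by (cases m)
  define X where "X = push (t b0) (src G a0) (rg G b0) i (pull (t a0) (src G a0) (rg G b0) j f)"
  \<comment> \<open>Both edges leave the same vertex, so the sum contains both corrections or
    neither.\<close>
  have mem: "a0 \<in> out G v \<longleftrightarrow> b0 \<in> out G v" using a0 b0 src_eq by (simp add: out_def)
  have "(\<Sum>a\<in>out G v. base (Ed a i) (twist (Gh a j) f) + twist (Ed a i) (base (Gh a j) f)) =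
      (\<Sum>a\<in>out G v. (if a = b0 then - X else 0) + (if a = a0 then X else 0))"
    by (rule sum.cong)
      (auto simp: X_def linear_ops src_eq a0_neq_b0
        push_pull_independent[of "t b0" "src G a0" "rg G a0" i "t a0" "src G a0" j f "rg G b0"])
  also have "\<dots> = 0"
    using mem row_finite[OF v(1)] by (simp add: sum.distrib)
  finally have "(\<Sum>a\<in>out G v. base (Ed a i) (twist (Gh a j) f) + twist (Ed a i) (base (Gh a j) f)) = 0" .
  then have "(\<Sum>a\<in>out G v. base (Ed a i) (twist (Gh a j) f)) +
      (\<Sum>a\<in>out G v. twist (Ed a i) (base (Gh a j) f)) = 0"
    by (simp only: sum.distrib)
  moreover have "snd (\<Sum>a\<in>out G v. act (Ed a i) (act (Gh a j) m)) =
      (\<Sum>a\<in>out G v. base (Ed a i) (base (Gh a j) g)) +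
      ((\<Sum>a\<in>out G v. base (Ed a i) (twist (Gh a j) f)) +
      (\<Sum>a\<in>out G v. twist (Ed a i) (base (Gh a j) f)))"
    by (simp add: m act_def snd_sum linear_ops sum.distrib add.assoc)
  ultimately show ?thesis
    using sum_push_pull[OF v i, of j f] sum_push_pull[OF v i, of j g]
    by (intro prod_eqI) (simp_all add: m act_def fst_sum)
qed

text \<open>Corrections survive only for \<open>a = b0\<close> and \<open>b = a0\<close>; there the
  undeformed relations for \<open>b0\<close> and for \<open>a0\<close> evaluate them to \<tau> and
  its negative.\<close>

lemma ghost_edge_act:
  fixes m :: "('v \<Rightarrow> nat \<Rightarrow> 'r::ring_1) \<times> ('v \<Rightarrow> nat \<Rightarrow> 'r)"
  assumes a: "a \<in> sedges G" and b: "b \<in> sedges G"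
  shows "(\<Sum>i = 1..max (wt G a) (wt G b). act (Gh a i) (act (Ed b i) m)) =
    (if a = b then act (Ve (rg G a)) m else 0)"
proof -
  obtain f g where m: "m = (f, g)" by (cases m)
  let ?I = "{1..max (wt G a) (wt G b)}"
  have base: "(\<Sum>i\<in>?I. base (Gh a i) (base (Ed b i) h)) = (if a = b then transport (rg G a) (rg G a) h else 0)"
    for h :: "'v \<Rightarrow> nat \<Rightarrow> 'r"
    using pull_push_edges[OF a b, of "max (wt G a) (wt G b)" "rg G a" "rg G b" h] by simp
  have 1: "(\<Sum>i\<in>?I. base (Gh a i) (twist (Ed b i) f)) =
      (if b = a0 \<and> a = b0 then transport (rg G b0) (rg G a0) f else 0)"
    using pull_push_edges[OF a b0, of "max (wt G a) (wt G b)" "rg G a" "rg G a0" f]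
    by (cases "b = a0") (simp_all add: src_eq linear_ops)
  \<comment> \<open>For \<open>a = b0\<close> the summation bound must reach the weight of
    \<open>a0\<close>, which it does by \<open>wt_eq\<close>.\<close>
  have 2: "(\<Sum>i\<in>?I. twist (Gh a i) (base (Ed b i) f)) =
      - (if b = a0 \<and> a = b0 then transport (rg G b0) (rg G a0) f else 0)"
    using pull_push_edges[OF a0 b, of "max (wt G a) (wt G b)" "rg G b0" "rg G b" f]
    by (cases "a = b0") (auto simp: wt_eq sum_negf)
  have "snd (\<Sum>i\<in>?I. act (Gh a i) (act (Ed b i) m)) =
      (\<Sum>i\<in>?I. base (Gh a i) (base (Ed b i) g)) +
      ((\<Sum>i\<in>?I. base (Gh a i) (twist (Ed b i) f)) + (\<Sum>i\<in>?I. twist (Gh a i) (base (Ed b i) f)))"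
    by (simp add: m act_def snd_sum linear_ops sum.distrib add.assoc)
  then have "snd (\<Sum>i\<in>?I. act (Gh a i) (act (Ed b i) m)) = (\<Sum>i\<in>?I. base (Gh a i) (base (Ed b i) g))"
    unfolding 1 2 by simp
  moreover have "fst (\<Sum>i\<in>?I. act (Gh a i) (act (Ed b i) m)) = (\<Sum>i\<in>?I. base (Gh a i) (base (Ed b i) f))"
    by (simp add: m act_def fst_sum)
  ultimately show ?thesis
    unfolding base by (intro prod_eqI) (simp_all add: m act_def)
qed

lemma relator_act:
  assumes "p \<in> relators G"
  shows "poly_act p m = 0"
  using assms
proof cases
  case (vertices v w)
  then show ?thesis
    by (cases m) (auto simp: poly_act_minus poly_act_mult poly_act_vertex act_def transport_ops linear_ops zero_prod_def)
next
  case (src_edge a i)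
  then show ?thesis
    by (cases m) (auto simp: poly_act_minus poly_act_mult poly_act_vertex poly_act_edge act_def
      transport_ops linear_ops zero_prod_def)
next
  case (edge_rg a i)
  then show ?thesis
    by (cases m) (auto simp: poly_act_minus poly_act_mult poly_act_vertex poly_act_edge act_def
      transport_ops linear_ops zero_prod_def)
next
  case (rg_ghost a i)
  then show ?thesis
    by (cases m) (auto simp: poly_act_minus poly_act_mult poly_act_vertex poly_act_ghost act_def
      transport_ops linear_ops zero_prod_def)
next
  \<comment> \<open>The correction of \<open>Gh b0\<close> reads at \<open>src G a0\<close>, hence
    the need for a common source.\<close>
  case (ghost_src a i)
  then show ?thesis
    by (cases m) (auto simp: poly_act_minus poly_act_mult poly_act_vertex poly_act_ghost act_def
      transport_ops linear_ops src_eq zero_prod_def)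
next
  case (edge_ghost v i j)
  have "(\<Sum>a\<in>out G v. poly_act (edge G a i * ghost G a j) m) =
      (\<Sum>a\<in>out G v. act (Ed a i) (act (Gh a j) m))"
    by (rule sum.cong) (auto simp: out_def poly_act_mult poly_act_edge poly_act_ghost)
  with edge_ghost show ?thesis
    using edge_ghost_act[of v i j m] by (simp add: poly_act_minus poly_act_sum poly_act_vertex)
next
  case (ghost_edge a b)
  then show ?thesis
    using ghost_edge_act[of a b m]
    by (simp add: poly_act_minus poly_act_sum poly_act_vertex poly_act_mult poly_act_edge poly_act_ghost)
qed

text \<open>The coordinate \<open>snd\<close> carries the multiples of \<open>\<epsilon>\<close>, and \<open>\<epsilon>\<^sup>2 = 0\<close>.\<close>
lemma edge_not_regular:
  assumes a0_1: "\<And>k. fst (t a0 k) \<noteq> 1" and b0_1: "fst (t b0 k) = 1"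
  shows "edge G a0 1 * q * edge G a0 1 - edge G a0 1
    \<notin> (relator_ideal G :: (('v, 'e) gen word \<Rightarrow>\<^sub>0 'r::ring_1) set)"
proof
  let ?e = "edge G a0 1 :: ('v, 'e) gen word \<Rightarrow>\<^sub>0 'r"
  assume "?e * q * ?e - ?e \<in> relator_ideal G"
  from poly_act_relator_ideal[OF word_action_axioms relator_act this]
  have eq: "poly_act ?e (poly_act q (poly_act ?e m)) = poly_act ?e m" for m
    by (simp add: poly_act_minus poly_act_mult mult.assoc)
  define N :: "(('v \<Rightarrow> nat \<Rightarrow> 'r) \<times> ('v \<Rightarrow> nat \<Rightarrow> 'r)) set" where "N = {m. fst m = 0}"
  have "push (t a0) v w 1 f = 0" for v w and f :: "'v \<Rightarrow> nat \<Rightarrow> 'r"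
  proof -
    have "(1, l) \<notin> range (t a0)" for l using a0_1 by (metis fst_conv rangeE)
    then show ?thesis by (auto simp: push_def fun_eq_iff)
  qed
  \<comment> \<open>Index 1 never occurs for \<open>t a0\<close>, so only the correction through
    \<open>b0\<close> remains.\<close>
  then have e: "poly_act ?e m = (0, push (t b0) (src G a0) (rg G a0) 1 (fst m))" for m
    using a0 by (cases m) (simp add: poly_act_edge act_def)
  have N: "poly_act q m \<in> N" if "m \<in> N" for m
  proof (rule poly_act_invariant[OF _ _ _ _ that])
    show "act x m \<in> N" if "m \<in> N" for x m
      using that by (cases m; cases x) (auto simp: N_def act_def linear_ops)
  qed (auto simp: N_def scale_def fun_eq_iff)
  \<comment> \<open>\<open>?e\<close> maps into \<open>N\<close> and kills \<open>N\<close>, while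
    \<open>q\<close> preserves \<open>N\<close>; the regularity equation then forces
    \<open>?e\<close> to act as zero.\<close>
  have "poly_act q (poly_act ?e m) \<in> N" for m by (rule N) (simp add: e N_def del: One_nat_def)
  then have "poly_act ?e m = 0" for m
    using eq[of m] by (subst eq[symmetric], subst e) (simp add: N_def linear_ops zero_prod_def del: One_nat_def)
  \<comment> \<open>On the constant function 1 the correction takes the value 1 at the coordinate
    that \<open>b0\<close> reaches from \<open>k\<close>.\<close>
  from this[of "(\<lambda>_ _. 1, 0)"] have "push (t b0) (src G a0) (rg G a0) 1 (\<lambda>_ _. 1 :: 'r) = 0"
    by (simp add: e zero_prod_def del: One_nat_def)
  then have "push (t b0) (src G a0) (rg G a0) 1 (\<lambda>_ _. 1 :: 'r) (src G a0) (snd (t b0 k)) = 0"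
    by simp
  moreover have "(1, snd (t b0 k)) \<in> range (t b0)" using b0_1 by (metis prod.collapse rangeI)
  ultimately show False by (simp add: push_def)
qed

end


section \<open>Failure of regularity\<close>

text \<open>Each edge may use all indices up to its weight, except that \<open>a0\<close> must avoid
  1; the infinitely many copies are distributed accordingly at every vertex.\<close>

lemma LV_graph_twist:
  fixes G :: "('v, 'e) wgraph"
  assumes "LV_graph G"
  obtains t a0 b0 k where "twisted_graph G t a0 b0" "\<And>k. fst (t a0 k) \<noteq> 1" "fst (t b0 k) = 1"
proof -
  interpret LV_graph G by fact
  obtain e where e: "e \<in> sedges G" using sedges_nonempty by auto
  define v0 where "v0 = src G e"
  have v0: "v0 \<in> verts G" "\<not> sink G v0"
    using e src_in_verts by (auto simp: v0_def sink_def out_def)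
  define M where "M v = {a \<in> out G v. wt G a = vwt G v}" for v
  obtain a0 b0 where ab: "a0 \<in> M v0" "b0 \<in> M v0" "a0 \<noteq> b0"
  proof -
    have "2 \<le> card (M v0)" using two_max_edges[OF v0] by (simp add: M_def)
    then show ?thesis using that by (auto simp: card_le_Suc_iff numeral_2_eq_2)
  qed
  have M_sedges: "a \<in> sedges G" "src G a = v" "wt G a = vwt G v" if "a \<in> M v" for a v
    using that by (auto simp: M_def out_def)
  define S where "S v = {(a, i). a \<in> out G v \<and> 1 \<le> i \<and> i \<le> wt G a \<and> (a = a0 \<longrightarrow> i \<noteq> 1)}" for v
  define good where "good v t \<longleftrightarrow>
      bij_betw (\<lambda>(a, k). t a k) (out G v \<times> UNIV) ({1..vwt G v} \<times> UNIV) \<and>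
      (\<forall>a\<in>out G v. fst ` range (t a) = {i. (a, i) \<in> S v})"
    for v and t :: "'e \<Rightarrow> nat \<Rightarrow> nat \<times> nat"
  have "\<exists>t. good v t" if v: "v \<in> verts G" "\<not> sink G v" for v
  proof -
    have fin: "finite (out G v)" using v row_finite by simp
    have S: "S v \<subseteq> out G v \<times> {1..vwt G v}"
      using fin by (auto simp: S_def vwt_def intro!: order_trans[OF _ Max_ge])
    \<comment> \<open>Index 2 is admissible for every edge, including \<open>a0\<close>.\<close>
    have P: "\<exists>i. (a, i) \<in> S v" if "a \<in> out G v" for a
      using wt_ge_2[of a] that by (intro exI[of _ 2]) (auto simp: S_def out_def)
    have Q: "\<exists>a. (a, i) \<in> S v" if i: "i \<in> {1..vwt G v}" for i
    proof -
      \<comment> \<open>An edge of maximal weight other than \<open>a0\<close> admits every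
        index.\<close>
      have "card (M v) \<ge> 2" using two_max_edges[OF v] by (simp add: M_def)
      then have "M v - {a0} \<noteq> {}"
        by (metis Diff_eq_empty_iff card_1_singleton_iff card.empty not_numeral_le_zero
            numeral_le_one_iff One_nat_def semiring_norm(69) subset_singletonD)
      then show ?thesis using i by (auto simp: S_def M_def)
    qed
    from bij_betw_copies[OF fin _ S P Q] show ?thesis unfolding good_def by (metis finite_atLeastAtMost)
  qed
  then obtain T where T: "\<And>v. v \<in> verts G \<Longrightarrow> \<not> sink G v \<Longrightarrow> good v (T v)" by metis
  define t where "t a = T (src G a) a" for a
  have range_t: "fst ` range (t a) = {i. (a, i) \<in> S (src G a)}" if "a \<in> sedges G" for a
  proof -
    have o: "a \<in> out G (src G a)" using that by (simp add: out_def)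
    then have "good (src G a) (T (src G a))"
      using T src_in_verts[OF that] by (auto simp: sink_def)
    then show ?thesis using o by (simp add: good_def t_def)
  qed
  have fst_t: "(a, fst (t a k)) \<in> S (src G a)" if "a \<in> sedges G" for a k
    using range_t[OF that] by blast
  have "twisted_graph G t a0 b0"
  proof
    fix v assume v: "v \<in> verts G" "\<not> sink G v"
    have "bij_betw (\<lambda>(a, k). T v a k) (out G v \<times> UNIV) ({1..vwt G v} \<times> UNIV)"
      using T[OF v] by (simp add: good_def)
    then show "bij_betw (\<lambda>(a, k). t a k) (out G v \<times> UNIV) ({1..vwt G v} \<times> UNIV)"
      by (rule bij_betw_cong[THEN iffD1, rotated]) (auto simp: t_def out_def)
  next
    show "fst (t a k) \<le> wt G a" if "a \<in> sedges G" for a k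
      using fst_t[OF that, of k] by (simp add: S_def)
  qed (use ab M_sedges in auto)
  moreover have "fst (t a0 k) \<noteq> 1" for k
    using fst_t[of a0 k] ab M_sedges by (auto simp: S_def)
  \<comment> \<open>Here the exact set of first entries matters: index 1 is admissible for
    \<open>b0\<close>, hence attained.\<close>
  moreover have "1 \<in> fst ` range (t b0)"
    using range_t[of b0] ab M_sedges[OF ab(2)] wt_pos[of b0] by (auto simp: S_def out_def)
  then obtain k where "fst (t b0 k) = 1" by auto
  ultimately show ?thesis by (rule that)
qed

text \<open>A quasi-inverse of the coset of \<open>?e\<close> would lift to some \<open>q\<close>
  with \<open>?e * q * ?e - ?e\<close> in the relator ideal, which the twisted module
  excludes.\<close>

lemma not_graded_regular:
  fixes G :: "('v, 'e) wgraph"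
  assumes "LV_graph G"
  shows "\<not> graded_von_neumann_regular (leavitt TYPE('r::ring_1) G) (leavitt_component TYPE('r) G)"
proof
  assume reg: "graded_von_neumann_regular (leavitt TYPE('r) G) (leavitt_component TYPE('r) G)"
  obtain t a0 b0 k where tw: "twisted_graph G t a0 b0"
    and t: "\<And>k. fst (t a0 k) \<noteq> 1" "fst (t b0 k) = 1"
    using LV_graph_twist[OF assms] by blast
  interpret twisted_graph G t a0 b0 by (rule tw)
  let ?S = "free_carrier G :: (('v, 'e) gen word \<Rightarrow>\<^sub>0 'r) set"
    and ?I = "relator_ideal G :: (('v, 'e) gen word \<Rightarrow>\<^sub>0 'r) set"
  let ?e = "edge G a0 1 :: ('v, 'e) gen word \<Rightarrow>\<^sub>0 'r"
  let ?cl = "\<lambda>p. cong_rel ?S ?I `` {p}"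
  have e: "?e = letter (Ed a0 1)" using wt_pos[OF a0] by (simp add: edge_def)
  have eS: "?e \<in> ?S"
    unfolding e using a0 wt_pos[OF a0] by (auto simp: letter_def free_carrier_def gens_def edge_gens_def)
  have "?cl ?e \<in> leavitt_component TYPE('r) G (Poly_Mapping.single 1 1)"
    unfolding leavitt_component_def
    using eS by (intro CollectI exI[of _ ?e]) (auto simp: e[unfolded One_nat_def] letter_def word_deg_def)
  then obtain B where B: "B \<in> carrier (leavitt TYPE('r) G)"
    "mult (leavitt TYPE('r) G) (mult (leavitt TYPE('r) G) (?cl ?e) B) (?cl ?e) = ?cl ?e"
    using reg unfolding graded_von_neumann_regular_def by blast
  obtain q where q: "q \<in> ?S" "B = ?cl q"
    using B(1) by (auto simp: leavitt_def quotient_ring_def quotient_def)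
  have mult: "mult (leavitt TYPE('r) G) (?cl x) (?cl y) = ?cl (x * y)" if "x \<in> ?S" "y \<in> ?S" for x y
    unfolding leavitt_def using that
    by (intro nu_ring_quotient_ring(3))
      (auto intro: free_carrier_closed relator_ideal_uminus relator_ideal.intros)
  have "?cl (?e * q * ?e) = ?cl ?e"
    using B(2) q eS by (simp add: mult free_carrier_closed)
  moreover have "equiv ?S (cong_rel ?S ?I)"
    by (rule equiv_cong_rel) (auto intro: relator_ideal_uminus relator_ideal.intros)
  ultimately have "(?e * q * ?e, ?e) \<in> cong_rel ?S ?I"
    using eS by (blast dest: eq_equiv_class)
  then show False
    using edge_not_regular[OF t, of q] by (simp add: cong_rel_def)
qed

theorem theorem48:
  fixes G :: "('v, 'e) wgraph"
  assumes "LV_graph G"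
  shows "\<not> von_neumann_regular (leavitt TYPE('r::ring_1_no_zero_divisors) G) \<and>
    \<not> graded_von_neumann_regular (leavitt TYPE('r) G) (leavitt_component TYPE('r) G)"
proof -
  \<comment> \<open>Homogeneous elements are elements of the algebra, so regularity would imply
    graded regularity.\<close>
  have "leavitt_component TYPE('r) G d \<subseteq> carrier (leavitt TYPE('r) G)" for d
    by (auto simp: leavitt_component_def leavitt_def quotient_ring_def quotient_def)
  then show ?thesis
    using not_graded_regular[OF assms, where 'r = 'r]
    unfolding von_neumann_regular_def graded_von_neumann_regular_def by blast
qed

end
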